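(* Let $q \geq 4$ be a prime power, let $d\ge 1$ be an integer, and let $1\le j\le d$. Then: (i) If $d \geq 3$, then $|Q_j(i+1)| < |Q_j(i)|$ for $0 \leq i \leq d-1$. (ii) If $j$ is odd, then $Q_j(1) \leq Q_j(i)$ for $0 \leq i \leq d$. (iii) If $j$ is even, then $Q_j(d-j+2) \leq Q_j(i)$ for $0 \leq i \leq d$.
   Context: Put $b=-q$. With Gaussian coefficients in base $b$, $\genfrac{[}{]}{0pt}{}{a}{k}_b = \prod_{h=0}^{k-1}\frac{b^{a-h}-1}{b^{k-h}-1}$ (and $0$ if $k<0$), for $0\le i,j\le d$, $$Q_j(i) = (-1)^j \sum_{h=0}^j (-q)^{\binom{j-h}{2} + hd} \genfrac{[}{]}{0pt}{}{d-h}{d-j}_b \genfrac{[}{]}{0pt}{}{d-i}{h}_b.$$ The numbers $Q_j(i)$, $0\le i\le d$, are the eigenvalues of the distance-$j$ graph of the Hermitian forms graph $Q_q(d)$, whose vertices are the Hermitian $d\times d$ matrices over $\mathbb{F}_{q^2}$, adjacent when their difference has rank 1. *)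

theory Defs
  imports Complex_Main "HOL-Number_Theory.Prime_Powers"
begin

text \<open>
  The Gaussian coefficient with base \<open>b\<close>. The arguments \<open>a\<close>, \<open>k\<close> are integers, so that \<open>a - h\<close>
  is not truncated. The division never degenerates when \<open>b\<close> is neither zero nor a root of unity:
  the denominators are \<open>b\<^sup>m - 1\<close> with \<open>1 \<le> m \<le> k\<close>.
\<close>

definition gauss_coeff :: "real \<Rightarrow> int \<Rightarrow> int \<Rightarrow> real" where
  "gauss_coeff b a k =
     (if k < 0 then 0
      else (\<Prod>h<nat k. (b powi (a - int h) - 1) / (b powi (k - int h) - 1)))"

text \<open>
  \<open>herm_eigenvalue q d j i\<close> is \<open>Q\<^sub>j(i)\<close>, the eigenvalue with index \<open>i\<close> of the distance-\<open>j\<close> graph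
  of the Hermitian forms graph \<open>Q\<^sub>q(d)\<close>, given by its explicit formula; it is meant for
  \<open>0 \<le> i, j \<le> d\<close>.
\<close>

definition herm_eigenvalue :: "nat \<Rightarrow> nat \<Rightarrow> nat \<Rightarrow> nat \<Rightarrow> real" where
  "herm_eigenvalue q d j i =
     (-1) ^ j *
     (\<Sum>h = 0..j. (- real q) ^ (((j - h) choose 2) + h * d)
        * gauss_coeff (- real q) (int d - int h) (int d - int j)
        * gauss_coeff (- real q) (int d - int i) (int h))"

end

theory Submission
  imports Defs
begin

text \<open>
  The \<open>q\<close>-Pascal rule turns the difference of consecutive eigenvalues into an eigenvalue of the
  next smaller graph: \<open>Q\<^sub>j\<^sup>d(i) - Q\<^sub>j\<^sup>d(i+1) = -(-q)\<^bsup>2d-i-1\<^esup> Q\<^sub>j\<^sub>-\<^sub>1\<^bsup>d-1\<^esup>(i)\<close>. By induction on \<open>j\<close>, and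
  downwards on \<open>i\<close> from the single term \<open>Q\<^sub>j\<^sup>d(d)\<close>, the number \<open>\<bar>Q\<^sub>j\<^sup>d(i+1)\<bar>\<close> is at most \<open>1/(q-1)\<close>
  times the absolute value of this difference. For \<open>q \<ge> 4\<close> this is less than one half, so the
  absolute values decrease strictly in \<open>i\<close> and \<open>Q\<^sub>j\<^sup>d(i)\<close> has the sign of the difference. Following the
  signs down the recurrence locates the first negative eigenvalue, which is the least one.
\<close>

subsection \<open>Gaussian coefficients with negative base\<close>

lemma power_ne_1:
  fixes b :: real
  assumes "b < -1" "m > 0"
  shows "b ^ m \<noteq> 1"
proof -
  have "\<bar>b\<bar> ^ m > 1"
    using assms by (intro one_less_power) auto
  then show ?thesis
    by (auto simp flip: power_abs)
qed

lemma power_int_ne_1: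
  fixes b :: real
  assumes "b < -1" "m > 0"
  shows "b powi m \<noteq> 1"
  using power_ne_1[OF assms(1), of "nat m"] assms(2) by (simp add: power_int_def)

lemma gauss_coeff_0 [simp]: "gauss_coeff b a 0 = 1"
  by (simp add: gauss_coeff_def)

lemma gauss_coeff_Suc:
  "gauss_coeff b a (int (Suc k))
     = (b powi a - 1) / (b powi int (Suc k) - 1) * gauss_coeff b (a - 1) (int k)"
  unfolding gauss_coeff_def nat_int
  by (subst prod.lessThan_Suc_shift) (simp add: algebra_simps)

text \<open>Collecting the denominators under the reindexing \<open>m = k - h\<close> makes them
  independent of \<open>a\<close>, so coefficients with different upper index can be compared
  through their numerators.\<close>

lemma gauss_coeff_int:
  "gauss_coeff b a (int k)
     = (\<Prod>h<k. b powi (a - int h) - 1) / (\<Prod>m=1..k. b powi int m - 1)"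
proof (induction k arbitrary: a)
  case 0
  then show ?case by simp
next
  case (Suc k)
  have "(\<Prod>h<Suc k. b powi (a - int h) - 1)
      = (b powi a - 1) * (\<Prod>h<k. b powi (a - 1 - int h) - 1)"
    by (subst prod.lessThan_Suc_shift) (simp add: algebra_simps)
  moreover have "(\<Prod>m=1..Suc k. b powi int m - 1)
      = (b powi int (Suc k) - 1) * (\<Prod>m=1..k. b powi int m - 1)"
    by (subst prod.nat_ivl_Suc') simp_all
  ultimately show ?case
    by (simp only: gauss_coeff_Suc Suc.IH times_divide_times_eq)
qed

lemma gauss_coeff_diff1_Suc:
  "gauss_coeff b (a - 1) (int (Suc k))
     = (b powi (a - int (Suc k)) - 1) / (b powi int (Suc k) - 1) * gauss_coeff b (a - 1) (int k)"
proof -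
  have "(\<Prod>h<Suc k. b powi (a - 1 - int h) - 1)
      = (b powi (a - int (Suc k)) - 1) * (\<Prod>h<k. b powi (a - 1 - int h) - 1)"
    by (simp add: algebra_simps)
  moreover have "(\<Prod>m=1..Suc k. b powi int m - 1)
      = (b powi int (Suc k) - 1) * (\<Prod>m=1..k. b powi int m - 1)"
    by (subst prod.nat_ivl_Suc') simp_all
  ultimately show ?thesis
    by (simp only: gauss_coeff_int times_divide_times_eq)
qed

text \<open>\<open>gauss_coeff_Suc\<close> and \<open>gauss_coeff_diff1_Suc\<close> write both
  coefficients of lower index \<open>Suc k\<close> as multiples of
  \<open>gauss_coeff b (a - 1) (int k)\<close>. What remains is the identity \<open>quot\<close>
  between the two multipliers.\<close>

lemma gauss_coeff_Pascal:
  assumes "b < -1"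
  shows "gauss_coeff b a (int (Suc k))
     = gauss_coeff b (a - 1) (int (Suc k))
       + b powi (a - int (Suc k)) * gauss_coeff b (a - 1) (int k)"
proof -
  have ne: "b powi int (Suc k) - 1 \<noteq> 0"
    using power_int_ne_1[OF assms, of "int (Suc k)"] by simp
  have split: "b powi a = b powi (a - int (Suc k)) * b powi int (Suc k)"
    using assms by (subst power_int_add[symmetric]) auto
  have quot: "(b powi a - 1) / (b powi int (Suc k) - 1)
      = (b powi (a - int (Suc k)) - 1) / (b powi int (Suc k) - 1) + b powi (a - int (Suc k))"
    using ne unfolding split by (simp add: field_simps del: of_nat_Suc power_int_of_nat)
  show ?thesis
    unfolding gauss_coeff_Suc[of b a] gauss_coeff_diff1_Suc quot by (simp only: ring_distribs)
qed

lemma gauss_coeff_diff1: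
  assumes "b < -1"
  shows "(b powi a - 1) * gauss_coeff b (a - 1) (int k)
     = (b powi (a - int k) - 1) * gauss_coeff b a (int k)"
proof (cases k)
  case (Suc n)
  have "b powi int (Suc n) - 1 \<noteq> 0"
    using power_int_ne_1[OF assms, of "int (Suc n)"] by simp
  then show ?thesis
    unfolding Suc gauss_coeff_Suc[of b a] gauss_coeff_diff1_Suc by simp
qed simp

lemma gauss_coeff_eq_0:
  assumes "n < k"
  shows "gauss_coeff b (int n) (int k) = 0"
proof -
  have "(\<Prod>h<k. b powi (int n - int h) - 1) = 0"
    using assms by (intro prod_zero) (auto intro!: bexI[of _ n])
  then show ?thesis by (simp add: gauss_coeff_int)
qed

section \<open>Signs of Gaussian coefficients\<close>

lemma power_minus_1_sign:
  fixes b :: real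
  assumes "b < -1" "m > 0"
  shows "0 < (-1) ^ m * (b ^ m - 1)"
proof -
  have "(-1) ^ m * b ^ m = (- b) ^ m"
    by (metis mult_minus1 power_mult_distrib)
  moreover have "(- b) ^ m > 1"
    using assms by (intro one_less_power) auto
  moreover have "(-1::real) ^ m \<le> 1"
    by (cases "even m") auto
  ultimately show ?thesis
    by (simp add: right_diff_distrib)
qed

text \<open>Each of the \<open>k\<close> quotients \<open>(b ^ (r + m) - 1) / (b ^ r - 1)\<close>
  has sign \<open>(-1) ^ m\<close>, because \<open>b ^ r - 1\<close> has the sign of
  \<open>b ^ r\<close>.\<close>

lemma gauss_coeff_sign:
  assumes "b < -1"
  shows "0 < (-1) ^ (k * m) * gauss_coeff b (int (k + m)) (int k)"
proof (induction k)
  case 0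
  then show ?case by simp
next
  case (Suc k)
  have "0 < ((-1) ^ (Suc k + m) * (b ^ (Suc k + m) - 1)) / ((-1) ^ Suc k * (b ^ Suc k - 1))"
    using assms by (intro divide_pos_pos power_minus_1_sign) auto
  also have "\<dots> = (-1) ^ m * ((b ^ (Suc k + m) - 1) / (b ^ Suc k - 1))"
  proof -
    have "(-1::real) ^ (Suc k + m) = (-1) ^ Suc k * (-1) ^ m" "(-1::real) ^ Suc k \<noteq> 0"
      by (simp_all add: power_add)
    then show ?thesis
      by (metis mult.assoc mult_divide_mult_cancel_left times_divide_eq_right)
  qed
  finally have "0 < (-1) ^ m * ((b ^ (Suc k + m) - 1) / (b ^ Suc k - 1))
      * ((-1) ^ (k * m) * gauss_coeff b (int (k + m)) (int k))"
    using Suc.IH by (rule mult_pos_pos)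
  also have "\<dots> = (-1) ^ (Suc k * m) *
      ((b ^ (Suc k + m) - 1) / (b ^ Suc k - 1) * gauss_coeff b (int (k + m)) (int k))"
    by (simp add: power_add)
  also have "(b ^ (Suc k + m) - 1) / (b ^ Suc k - 1) * gauss_coeff b (int (k + m)) (int k)
      = gauss_coeff b (int (Suc k + m)) (int (Suc k))"
    unfolding gauss_coeff_Suc power_int_of_nat by simp
  finally show ?case .
qed

subsection \<open>The recurrence\<close>

lemma herm_eigenvalue_0 [simp]:
  assumes "q \<ge> 2"
  shows "herm_eigenvalue q d 0 i = 1"
proof -
  have b: "- real q < -1" using assms by simp
  have "gauss_coeff (- real q) (int d) (int d) = 1"
  proof (induction d)
    case (Suc d)
    have "(- real q) powi int (Suc d) \<noteq> 1"
      using b by (intro power_int_ne_1) auto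
    then show ?case
      unfolding gauss_coeff_Suc using Suc.IH by simp
  qed simp
  then show ?thesis by (simp add: herm_eigenvalue_def numeral_2_eq_2)
qed

text \<open>The index \<open>i\<close> enters only through the last Gaussian coefficient. By the
  Pascal rule, term \<open>Suc h\<close> of the difference is a fixed power of \<open>b\<close>
  times term \<open>h\<close> of the smaller eigenvalue, while the terms with \<open>h = 0\<close>
  cancel.\<close>

lemma herm_eigenvalue_diff:
  assumes "q \<ge> 2" "i \<le> d"
  shows "herm_eigenvalue q (Suc d) (Suc j) i - herm_eigenvalue q (Suc d) (Suc j) (Suc i)
    = - ((- real q) ^ (2 * d + 1 - i)) * herm_eigenvalue q d j i"
proof -
  define b where "b = - real q"
  have b: "b < -1" using assms by (simp add: b_def)
  define t where "t i h = b ^ (((Suc j - h) choose 2) + h * Suc d)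
        * gauss_coeff b (int (Suc d) - int h) (int (Suc d) - int (Suc j))
        * gauss_coeff b (int (Suc d) - int i) (int h)" for i h
  define u where "u h = b ^ (((j - h) choose 2) + h * d)
        * gauss_coeff b (int d - int h) (int d - int j)
        * gauss_coeff b (int d - int i) (int h)" for h
  have step: "t i (Suc h) - t (Suc i) (Suc h) = b ^ (2 * d + 1 - i) * u h" for h
  proof -
    define g where "g = gauss_coeff b (int d - int h) (int d - int j)"
    define e where "e = ((j - h) choose 2) + Suc h * Suc d"
    have "t i (Suc h) - t (Suc i) (Suc h) = b ^ e * g *
        (gauss_coeff b (int (Suc d) - int i) (int (Suc h))
         - gauss_coeff b (int (Suc d) - int i - 1) (int (Suc h)))"
      by (simp add: t_def g_def e_def algebra_simps)
    also have "\<dots> = b ^ e * g * (b powi (int d - int i - int h)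
        * gauss_coeff b (int d - int i) (int h))"
      using gauss_coeff_Pascal[OF b, of "int (Suc d) - int i" h] by (simp add: algebra_simps)
    also have "b ^ e * g * (b powi (int d - int i - int h) * gauss_coeff b (int d - int i) (int h))
        = (b powi int e * b powi (int d - int i - int h)) * g * gauss_coeff b (int d - int i) (int h)"
      by simp
    \<comment> \<open>The exponent from the Pascal rule may be negative, so the powers are merged
      with \<open>powi\<close>; only the total is turned back into a natural number.\<close>
    also have "b powi int e * b powi (int d - int i - int h)
        = b powi (int e + (int d - int i - int h))"
      using b by (intro power_int_add[symmetric]) auto
    also have "int e + (int d - int i - int h)
        = int ((2 * d + 1 - i) + (((j - h) choose 2) + h * d))"
      using assms(2) by (simp add: e_def of_nat_diff algebra_simps)
    also have "b powi \<dots> = b ^ (2 * d + 1 - i) * b ^ (((j - h) choose 2) + h * d)"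
      by (simp only: power_int_of_nat power_add)
    finally show ?thesis by (simp add: u_def g_def)
  qed
  have t0: "t i 0 = t (Suc i) 0" by (simp add: t_def)
  have "herm_eigenvalue q (Suc d) (Suc j) i - herm_eigenvalue q (Suc d) (Suc j) (Suc i)
      = (-1) ^ Suc j * ((\<Sum>h=0..Suc j. t i h) - (\<Sum>h=0..Suc j. t (Suc i) h))"
    by (simp only: herm_eigenvalue_def t_def b_def right_diff_distrib)
  also have "(\<Sum>h=0..Suc j. t i h) - (\<Sum>h=0..Suc j. t (Suc i) h)
      = (\<Sum>h=0..j. t i (Suc h) - t (Suc i) (Suc h))"
    by (simp only: sum.atLeast0_atMost_Suc_shift sum_subtractf t0) simp
  also have "\<dots> = b ^ (2 * d + 1 - i) * (\<Sum>h=0..j. u h)"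
    by (simp only: step sum_distrib_left)
  also have "(-1) ^ Suc j * \<dots> = - (b ^ (2 * d + 1 - i)) * herm_eigenvalue q d j i"
    by (simp add: herm_eigenvalue_def u_def b_def)
  finally show ?thesis by (simp only: b_def)
qed

text \<open>At \<open>i = d\<close> the upper index of the last Gaussian coefficient is 0, so only
  the term \<open>h = 0\<close> survives.\<close>

lemma herm_eigenvalue_last:
  "herm_eigenvalue q d j d
     = (-1) ^ j * (- real q) ^ (j choose 2) * gauss_coeff (- real q) (int d) (int d - int j)"
proof -
  have "gauss_coeff (- real q) (int d - int d) (int h) = 0" if "h > 0" for h
    using gauss_coeff_eq_0[of 0 h "- real q"] that by simp
  then have "(\<Sum>h = 0..j. (- real q) ^ (((j - h) choose 2) + h * d)
        * gauss_coeff (- real q) (int d - int h) (int d - int j)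
        * gauss_coeff (- real q) (int d - int d) (int h))
      = (- real q) ^ (j choose 2) * gauss_coeff (- real q) (int d) (int d - int j)"
    by (subst sum.atLeast_Suc_atMost) (simp_all add: sum.neutral)
  then show ?thesis
    unfolding herm_eigenvalue_def by (simp only: mult.assoc)
qed

lemma herm_eigenvalue_last_ne_0:
  assumes "q \<ge> 2" "j \<le> d"
  shows "herm_eigenvalue q d j d \<noteq> 0"
proof -
  have "gauss_coeff (- real q) (int d) (int d - int j) \<noteq> 0"
    using gauss_coeff_sign[of "- real q" "d - j" j] assms by (auto simp: of_nat_diff)
  then show ?thesis
    using assms by (simp add: herm_eigenvalue_last)
qed

subsection \<open>Domination by the difference\<close>

text \<open>This starts the downward induction on \<open>i\<close>. Both sides have closed forms
  whose Gaussian coefficients are linked by \<open>gauss_coeff_diff1\<close>, which leaves an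
  inequality between powers of \<open>q\<close>.\<close>

lemma herm_eigenvalue_last_dominated:
  assumes q: "q \<ge> 2" and j: "j \<le> d"
  shows "(real q - 1) * \<bar>herm_eigenvalue q (Suc d) (Suc j) (Suc d)\<bar>
    \<le> real q ^ Suc d * \<bar>herm_eigenvalue q d j d\<bar>"
proof -
  define x where "x = real q"
  have x: "x \<ge> 2" using q by (simp add: x_def)
  define g where "g = gauss_coeff (- x) (int d) (int d - int j)"
  define g' where "g' = gauss_coeff (- x) (int (Suc d)) (int d - int j)"
  have rel: "((- x) ^ Suc d - 1) * g = ((- x) ^ Suc j - 1) * g'"
  proof -
    have "int (Suc d) - int (d - j) = int (Suc j)"
      using j by simp
    then show ?thesis
      using gauss_coeff_diff1[of "- x" "int (Suc d)" "d - j"] x j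
      unfolding g_def g'_def by (simp add: of_nat_diff del: power_Suc flip: power_int_of_nat)
  qed
  have "(-x) ^ Suc d \<noteq> 1"
    using power_int_ne_1[of "-x" "int (Suc d)"] x by (simp only: power_int_of_nat) simp
  then have pos: "0 < \<bar>(- x) ^ Suc d - 1\<bar>" by simp
  have key: "(x - 1) * \<bar>(- x) ^ Suc d - 1\<bar> \<le> x ^ (Suc d - j) * \<bar>(- x) ^ Suc j - 1\<bar>"
  proof -
    have up: "\<bar>(- x) ^ Suc d - 1\<bar> \<le> x ^ Suc d + 1"
      using abs_triangle_ineq4[of "(- x) ^ Suc d" 1] x by (simp add: power_abs abs_mult)
    have split: "x ^ (Suc d - j) * x ^ Suc j = x ^ Suc (Suc d)"
      using j by (subst power_add[symmetric]) simp
    \<comment> \<open>The left side is \<open>(x - 1) * (x ^ Suc d + 1)\<close> expanded. The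
      delicate case is odd \<open>j\<close>, where the 1 may reduce the absolute value; then
      \<open>j \<ge> 1\<close> bounds the loss by \<open>x ^ d\<close>.\<close>
    have "x ^ Suc (Suc d) - x ^ Suc d + x - 1 \<le> x ^ (Suc d - j) * \<bar>(- x) ^ Suc j - 1\<bar>"
    proof (cases "even j")
      case True
      then have "(- x) ^ Suc j = - (x ^ Suc j)"
        by simp
      moreover have "x ^ Suc j \<ge> 0"
        using x by simp
      ultimately have "\<bar>(- x) ^ Suc j - 1\<bar> = x ^ Suc j + 1"
        by linarith
      moreover have "x ^ (Suc d - j) \<ge> 0" "x \<le> x ^ Suc d"
        using x by (auto intro: self_le_power)
      ultimately show ?thesis
        using split by (simp only: distrib_left)
    next
      case False
      then have "\<bar>(- x) ^ Suc j - 1\<bar> \<ge> x ^ Suc j - 1"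
        by simp
      then have "x ^ (Suc d - j) * (x ^ Suc j - 1) \<le> x ^ (Suc d - j) * \<bar>(- x) ^ Suc j - 1\<bar>"
        using x by (intro mult_left_mono) auto
      moreover have "x ^ (Suc d - j) \<le> x ^ d"
        using x False by (intro power_increasing) (auto elim: oddE)
      moreover have "x ^ d + x \<le> x ^ Suc d + 1"
      proof -
        have "0 \<le> (x - 1) * (x ^ d - 1)"
          using x by (intro mult_nonneg_nonneg) auto
        then show ?thesis by (simp add: algebra_simps)
      qed
      ultimately show ?thesis
        using split by (simp only: right_diff_distrib)
    qed
    moreover have "(x - 1) * \<bar>(- x) ^ Suc d - 1\<bar> \<le> (x - 1) * (x ^ Suc d + 1)"
      using up x by (intro mult_left_mono) auto
    ultimately show ?thesis by (simp add: algebra_simps)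
  qed
  have "\<bar>(- x) ^ Suc d - 1\<bar> * ((x - 1) * \<bar>g'\<bar>) = ((x - 1) * \<bar>(- x) ^ Suc d - 1\<bar>) * \<bar>g'\<bar>"
    by simp
  also have "\<dots> \<le> (x ^ (Suc d - j) * \<bar>(- x) ^ Suc j - 1\<bar>) * \<bar>g'\<bar>"
    using key by (rule mult_right_mono) simp
  also have "\<dots> = x ^ (Suc d - j) * \<bar>((- x) ^ Suc j - 1) * g'\<bar>"
    by (simp only: abs_mult mult.assoc)
  also have "\<dots> = \<bar>(- x) ^ Suc d - 1\<bar> * (x ^ (Suc d - j) * \<bar>g\<bar>)"
    by (simp only: rel[symmetric] abs_mult mult.left_commute)
  finally have "(x - 1) * \<bar>g'\<bar> \<le> x ^ (Suc d - j) * \<bar>g\<bar>"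
    using pos by (simp only: mult_le_cancel_left_pos)
  then have "x ^ (Suc j choose 2) * ((x - 1) * \<bar>g'\<bar>)
      \<le> x ^ (Suc j choose 2) * (x ^ (Suc d - j) * \<bar>g\<bar>)"
    using x by (intro mult_left_mono) auto
  also have "x ^ (Suc j choose 2) * (x ^ (Suc d - j) * \<bar>g\<bar>)
      = x ^ ((Suc j choose 2) + (Suc d - j)) * \<bar>g\<bar>"
    by (simp add: power_add)
  also have "(Suc j choose 2) + (Suc d - j) = Suc d + (j choose 2)"
    using j by (simp add: numeral_2_eq_2)
  finally show ?thesis
    using x by (simp add: herm_eigenvalue_last abs_mult power_abs g_def g'_def x_def power_add ac_simps)
qed

text \<open>Downward induction on \<open>i\<close>. Monotonicity of the smaller eigenvalues is a
  premise here, to be supplied by the outer induction on \<open>j\<close>.\<close>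

lemma herm_eigenvalue_dominated_step:
  assumes "q \<ge> 4" "j \<le> d" "i \<le> d"
    and "\<And>i. i < d \<Longrightarrow> \<bar>herm_eigenvalue q d j (Suc i)\<bar> \<le> \<bar>herm_eigenvalue q d j i\<bar>"
  shows "(real q - 1) * \<bar>herm_eigenvalue q (Suc d) (Suc j) (Suc i)\<bar>
    \<le> real q ^ (2 * d + 1 - i) * \<bar>herm_eigenvalue q d j i\<bar>"
  using assms(3)
proof (induction rule: inc_induct)
  case base
  then show ?case
    using herm_eigenvalue_last_dominated[of q j d] assms(1,2) by (simp del: power_Suc)
next
  case (step i)
  define x where "x = real q"
  have x: "x \<ge> 4" using assms(1) by (simp add: x_def)
  define p where "p = x ^ (2 * d + 1 - Suc i)"
  have p: "p \<ge> 0" using x by (simp add: p_def)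
  have px: "x ^ (2 * d + 1 - i) = x * p"
    using step(2) unfolding p_def by (subst power_Suc[symmetric]) (simp add: Suc_diff_le del: power_Suc)
  let ?Q = "herm_eigenvalue q (Suc d) (Suc j)" and ?R = "\<lambda>i. \<bar>herm_eigenvalue q d j i\<bar>"
  have "\<bar>?Q (Suc i) - ?Q (Suc (Suc i))\<bar> = p * ?R (Suc i)"
    using herm_eigenvalue_diff[of q "Suc i" d j] assms(1) step(2)
    by (simp add: abs_mult power_abs p_def x_def)
  then have "\<bar>?Q (Suc i)\<bar> \<le> p * ?R (Suc i) + \<bar>?Q (Suc (Suc i))\<bar>"
    by linarith
  then have "(x - 1) * \<bar>?Q (Suc i)\<bar> \<le> (x - 1) * (p * ?R (Suc i) + \<bar>?Q (Suc (Suc i))\<bar>)"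
    using x by (intro mult_left_mono) auto
  also have "\<dots> = (x - 1) * (p * ?R (Suc i)) + (x - 1) * \<bar>?Q (Suc (Suc i))\<bar>"
    by (simp only: distrib_left)
  also have "\<dots> \<le> (x - 1) * (p * ?R (Suc i)) + p * ?R (Suc i)"
    using step.IH by (simp add: p_def x_def)
  \<comment> \<open>The coefficients \<open>x - 1\<close> and 1 add up to exactly the factor
    \<open>x\<close> by which the power of \<open>q\<close> grows when \<open>i\<close> drops by
    one, so the constant \<open>q - 1\<close> is reproduced.\<close>
  also have "\<dots> = (x * p) * ?R (Suc i)"
    by (simp add: algebra_simps)
  also have "\<dots> \<le> (x * p) * ?R i"
    using assms(4)[of i] step(2) x p by (intro mult_left_mono) auto
  finally show ?case by (simp only: px[unfolded x_def] x_def)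
qed

lemma herm_eigenvalue_dominated:
  assumes "q \<ge> 4" "j \<le> d" "i \<le> d"
  shows "(real q - 1) * \<bar>herm_eigenvalue q (Suc d) (Suc j) (Suc i)\<bar>
    \<le> real q ^ (2 * d + 1 - i) * \<bar>herm_eigenvalue q d j i\<bar>"
  using assms(2,3)
proof (induction j arbitrary: d i)
  case 0
  show ?case
    using 0 assms(1) by (intro herm_eigenvalue_dominated_step) auto
next
  case (Suc j)
  obtain d' where d: "d = Suc d'" using Suc.prems by (cases d) auto
  \<comment> \<open>The induction hypothesis bounds \<open>\<bar>?Q (Suc i)\<bar>\<close> by half
    the absolute difference, and the triangle inequality yields the monotonicity that the step lemma
    requires.\<close>
  have "\<bar>herm_eigenvalue q d (Suc j) (Suc i)\<bar> \<le> \<bar>herm_eigenvalue q d (Suc j) i\<bar>"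
    if "i < d" for i
  proof -
    let ?Q = "herm_eigenvalue q d (Suc j)"
    have "\<bar>?Q i - ?Q (Suc i)\<bar> = real q ^ (2 * d' + 1 - i) * \<bar>herm_eigenvalue q d' j i\<bar>"
      using herm_eigenvalue_diff[of q i d' j] assms(1) that
      by (simp add: d abs_mult power_abs)
    then have "(real q - 1) * \<bar>?Q (Suc i)\<bar> \<le> \<bar>?Q i - ?Q (Suc i)\<bar>"
      using Suc.IH[of d' i] Suc.prems that d by simp
    moreover have "2 * \<bar>?Q (Suc i)\<bar> \<le> (real q - 1) * \<bar>?Q (Suc i)\<bar>"
      using assms(1) by (intro mult_right_mono) auto
    ultimately show ?thesis by linarith
  qed
  then show ?case
    using Suc.prems assms(1) by (intro herm_eigenvalue_dominated_step) auto
qed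

text \<open>The constant 3 is the least value of \<open>q - 1\<close>. It forces
  \<open>\<bar>Q i\<bar>\<close> to be at least twice \<open>\<bar>Q (Suc i)\<bar>\<close> and gives
  \<open>Q i\<close> the sign of the difference.\<close>

lemma herm_eigenvalue_dominated_diff:
  assumes "q \<ge> 4" "j \<le> d" "i \<le> d"
  defines "Q \<equiv> herm_eigenvalue q (Suc d) (Suc j)"
  shows "3 * \<bar>Q (Suc i)\<bar> \<le> \<bar>Q i - Q (Suc i)\<bar>"
proof -
  have "\<bar>Q i - Q (Suc i)\<bar> = real q ^ (2 * d + 1 - i) * \<bar>herm_eigenvalue q d j i\<bar>"
    using herm_eigenvalue_diff[of q i d j] assms by (simp add: abs_mult power_abs)
  then have "(real q - 1) * \<bar>Q (Suc i)\<bar> \<le> \<bar>Q i - Q (Suc i)\<bar>"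
    using herm_eigenvalue_dominated[of q j d i] assms by simp
  moreover have "3 * \<bar>Q (Suc i)\<bar> \<le> (real q - 1) * \<bar>Q (Suc i)\<bar>"
    using assms(1) by (intro mult_right_mono) auto
  ultimately show ?thesis by linarith
qed

text \<open>Nonvanishing spreads downwards from the last index, where the closed form is nonzero; it
  is what makes the decrease of absolute values strict.\<close>

lemma herm_eigenvalue_ne_0:
  assumes "q \<ge> 4" "j \<le> d" "i \<le> d"
  shows "herm_eigenvalue q d j i \<noteq> 0"
proof (cases j)
  case (Suc j')
  then obtain d' where d: "d = Suc d'" using assms by (cases d) auto
  show ?thesis
    using assms(3)
  proof (induction rule: inc_induct)
    case base
    show ?case using assms by (intro herm_eigenvalue_last_ne_0) auto
  next
    case (step i)
    then show ?case
      using herm_eigenvalue_dominated_diff[of q j' d' i] assms Suc d by force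
  qed
qed (use assms in simp)

lemma herm_eigenvalue_abs_less:
  assumes "q \<ge> 4" "1 \<le> j" "j \<le> d" "i < d"
  shows "\<bar>herm_eigenvalue q d j (Suc i)\<bar> < \<bar>herm_eigenvalue q d j i\<bar>"
proof -
  obtain d' j' where "d = Suc d'" "j = Suc j'"
    using assms by (metis One_nat_def Suc_le_D le_trans)
  then show ?thesis
    using herm_eigenvalue_dominated_diff[of q j' d' i] herm_eigenvalue_ne_0[of q j d "Suc i"] assms
    by force
qed

lemma herm_eigenvalue_abs_antimono:
  assumes "q \<ge> 4" "1 \<le> j" "j \<le> d" "i \<le> i'" "i' \<le> d"
  shows "\<bar>herm_eigenvalue q d j i'\<bar> \<le> \<bar>herm_eigenvalue q d j i\<bar>"
  using assms(4,5)
proof (induction rule: dec_induct)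
  case (step n)
  then show ?case
    using herm_eigenvalue_abs_less[OF assms(1-3), of n] by simp
qed simp

subsection \<open>Signs\<close>

text \<open>\<open>Q i\<close> has the sign of the difference, which the recurrence gives. A
  positive product encodes equality of signs so that steps can be chained by multiplication.\<close>

lemma herm_eigenvalue_sign_step:
  assumes "q \<ge> 4" "j \<le> d" "i \<le> d"
  shows "0 < (-1) ^ i * (herm_eigenvalue q (Suc d) (Suc j) i * herm_eigenvalue q d j i)"
proof -
  let ?Q = "herm_eigenvalue q (Suc d) (Suc j)" and ?R = "herm_eigenvalue q d j i"
  define p where "p = real q ^ (2 * d + 1 - i)"
  have p: "p > 0" using assms(1) by (simp add: p_def)
  have R: "?R \<noteq> 0" using assms by (intro herm_eigenvalue_ne_0) auto
  \<comment> \<open>The exponent has parity opposite to \<open>i\<close>, which absorbs the leading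
    minus sign.\<close>
  have "- ((- real q) ^ (2 * d + 1 - i)) = (-1) ^ i * p"
    using assms(3) unfolding p_def
    by (cases "even i") (auto simp: power_minus_even power_minus_odd)
  then have "?Q i - ?Q (Suc i) = (-1) ^ i * p * ?R"
    using herm_eigenvalue_diff[of q i d j] assms by simp
  then have "p * ?R = (-1) ^ i * (?Q i - ?Q (Suc i))"
    by (cases "even i") auto
  then have D: "(-1) ^ i * (?Q i - ?Q (Suc i)) * (p * ?R) > 0"
  proof -
    have "(p * ?R)\<^sup>2 > 0" using p R by simp
    with \<open>p * ?R = _\<close> show ?thesis by (simp only: power2_eq_square)
  qed
  have "3 * \<bar>?Q (Suc i)\<bar> \<le> \<bar>?Q i - ?Q (Suc i)\<bar>"
    using assms by (rule herm_eigenvalue_dominated_diff)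
  then have "sgn (?Q i) = sgn (?Q i - ?Q (Suc i))"
    by (auto simp: sgn_if abs_if split: if_splits)
  moreover have "sgn ((-1) ^ i * (?Q i - ?Q (Suc i)) * (p * ?R)) = 1"
    using D by (simp only: sgn_pos)
  ultimately have "sgn ((-1) ^ i * (?Q i * ?R)) = 1"
    using p by (simp add: sgn_mult ac_simps)
  then show ?thesis by (simp only: sgn_1_pos)
qed

lemma herm_eigenvalue_sign:
  assumes "q \<ge> 4" "j \<le> d" "i \<le> d"
  shows "0 < (-1) ^ (i * m) * (herm_eigenvalue q (d + m) (j + m) i * herm_eigenvalue q d j i)"
proof (induction m)
  case 0
  then show ?case
    using herm_eigenvalue_ne_0[OF assms] by (simp add: zero_less_mult_iff) linarith
next
  case (Suc m)
  let ?Q = "\<lambda>m. herm_eigenvalue q (d + m) (j + m) i"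
  have "0 < (-1) ^ i * (?Q (Suc m) * ?Q m)"
    using herm_eigenvalue_sign_step[of q "j + m" "d + m" i] assms by simp
  then have "0 < ((-1) ^ i * (?Q (Suc m) * ?Q m)) * ((-1) ^ (i * m) * (?Q m * ?Q 0))"
    using Suc.IH by (intro mult_pos_pos[of "_ * _" "_ * _"]) simp_all
  \<comment> \<open>The intermediate eigenvalue occurs squared and does not affect the sign.\<close>
  also have "\<dots> = (?Q m)\<^sup>2 * ((-1) ^ (i * Suc m) * (?Q (Suc m) * ?Q 0))"
    by (simp add: power_add power2_eq_square)
  finally show ?case
    by (simp add: zero_less_mult_iff)
qed

section \<open>Locating the first negative eigenvalue\<close>

lemma herm_eigenvalue_1_neg:
  assumes "q \<ge> 4" "odd j" "j \<le> d"
  shows "herm_eigenvalue q d j 1 < 0"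
proof (cases "d = j")
  case True
  \<comment> \<open>The descent must stop at \<open>d = j = 1\<close>, to keep \<open>i = 1\<close>
    in range; there the eigenvalue is -1. For \<open>j < d\<close> it can continue to
    \<open>j = 0\<close>, where the eigenvalue is 1.\<close>
  obtain m where m: "j = 1 + m" "even m"
    using assms(2) by (auto elim!: oddE)
  show ?thesis
    using herm_eigenvalue_sign[of q 1 1 1 m] herm_eigenvalue_last[of q 1 1] assms(1) m True
    by (simp add: numeral_2_eq_2)
next
  case False
  then show ?thesis
    using herm_eigenvalue_sign[of q 0 "d - j" 1 j] assms by simp
qed

lemma herm_eigenvalue_even_pos:
  assumes "q \<ge> 4" "even j" "2 \<le> j" "j \<le> d" "i \<le> d - j + 1"
  shows "0 < herm_eigenvalue q d j i"
proof (cases "i \<le> d - j")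
  case True
  then show ?thesis
    using herm_eigenvalue_sign[of q 0 "d - j" i j] assms by simp
next
  case False
  \<comment> \<open>For \<open>i = d - j + 1\<close> the descent ends at \<open>j = 1\<close>, where
    \<open>i\<close> is the last index and the closed form gives sign \<open>(-1) ^ Suc n\<close>.
    The odd number \<open>m\<close> of steps contributes the same sign.\<close>
  define n where "n = d - j"
  have i: "i = n + 1" using False assms unfolding n_def by simp
  define m where "m = j - 1"
  have j: "j = 1 + m" using assms(3) by (simp add: m_def)
  with assms(2) have m: "odd m" by simp
  have d: "d = (n + 1) + m" using assms(4) j by (simp add: n_def)
  have "0 < (-1) ^ n * gauss_coeff (- real q) (int (n + 1)) (int n)"
    using gauss_coeff_sign[of "- real q" n 1] assms(1) by simp
  then have "0 < (-1) ^ Suc n * herm_eigenvalue q (n + 1) 1 (n + 1)"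
    by (simp add: herm_eigenvalue_last numeral_2_eq_2)
  moreover have "0 < (-1) ^ ((n + 1) * m)
      * (herm_eigenvalue q d j i * herm_eigenvalue q (n + 1) 1 (n + 1))"
    using herm_eigenvalue_sign[of q 1 "n + 1" "n + 1" m] assms(1) by (simp add: d j i)
  ultimately show ?thesis
    using m by (cases "even n") (auto simp: zero_less_mult_iff mult_less_0_iff)
qed

text \<open>An even number of descents leads to \<open>j = 2\<close>, where \<open>d - j + 2\<close>
  is the last index. There the closed form is \<open>- real q\<close> times a positive Gaussian
  coefficient.\<close>

lemma herm_eigenvalue_even_neg:
  assumes "q \<ge> 4" "even j" "2 \<le> j" "j \<le> d"
  shows "herm_eigenvalue q d j (d - j + 2) < 0"
proof -
  define n m where "n = d - j" and "m = j - 2"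
  have eqs: "d = (n + 2) + m" "j = 2 + m" "d - j + 2 = n + 2" and m: "even m"
    using assms by (simp_all add: n_def m_def)
  have "0 < gauss_coeff (- real q) (int (n + 2)) (int n)"
    using gauss_coeff_sign[of "- real q" n 2] assms(1) by simp
  then have "herm_eigenvalue q (n + 2) 2 (n + 2) < 0"
    using assms(1) by (simp add: herm_eigenvalue_last mult_less_0_iff)
  moreover have "0 < (-1) ^ ((n + 2) * m)
      * (herm_eigenvalue q d j (n + 2) * herm_eigenvalue q (n + 2) 2 (n + 2))"
    using herm_eigenvalue_sign[of q 2 "n + 2" "n + 2" m] assms(1) by (simp add: eqs(1,2))
  ultimately have "herm_eigenvalue q d j (n + 2) < 0"
    using m by (auto simp: zero_less_mult_iff)
  then show ?thesis by (simp only: eqs(3))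
qed

text \<open>Values before \<open>i'\<close> are positive, and those from \<open>i'\<close> on have
  absolute value at most that of the negative value at \<open>i'\<close>.\<close>

lemma herm_eigenvalue_neg_minimal:
  assumes "q \<ge> 4" "1 \<le> j" "j \<le> d" "i \<le> d" "i' \<le> d"
    and "herm_eigenvalue q d j i' < 0"
    and "i < i' \<Longrightarrow> 0 < herm_eigenvalue q d j i"
  shows "herm_eigenvalue q d j i' \<le> herm_eigenvalue q d j i"
proof (cases "i < i'")
  case False
  then show ?thesis
    using herm_eigenvalue_abs_antimono[of q j d i' i] assms by linarith
qed (use assms in force)

theorem theorem9p5:
  fixes q d j :: nat
  assumes "primepow q" and "q \<ge> 4" and "d \<ge> 1" and "1 \<le> j" and "j \<le> d"
  shows "(d \<ge> 3 \<longrightarrow>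
            (\<forall>i\<in>{0..d-1}. \<bar>herm_eigenvalue q d j (i + 1)\<bar> < \<bar>herm_eigenvalue q d j i\<bar>))
       \<and> (odd j \<longrightarrow>
            (\<forall>i\<in>{0..d}. herm_eigenvalue q d j 1 \<le> herm_eigenvalue q d j i))
       \<and> (even j \<longrightarrow>
            (\<forall>i\<in>{0..d}. herm_eigenvalue q d j (d - j + 2) \<le> herm_eigenvalue q d j i))"
proof (intro conjI impI ballI)
  fix i assume "i \<in> {0..d-1}"
  then show "\<bar>herm_eigenvalue q d j (i + 1)\<bar> < \<bar>herm_eigenvalue q d j i\<bar>"
    using herm_eigenvalue_abs_less[of q j d i] assms by simp
next
  fix i assume "odd j" "i \<in> {0..d}"
  moreover have "0 < herm_eigenvalue q d j 0"
    using herm_eigenvalue_sign[of q 0 "d - j" 0 j] assms by simp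
  ultimately show "herm_eigenvalue q d j 1 \<le> herm_eigenvalue q d j i"
    using assms herm_eigenvalue_1_neg[of q j d]
    by (intro herm_eigenvalue_neg_minimal) (auto simp: less_Suc_eq)
next
  fix i assume "even j" "i \<in> {0..d}"
  \<comment> \<open>This puts \<open>d - j + 2\<close> within the range of indices.\<close>
  moreover have "2 \<le> j"
    using \<open>even j\<close> assms(4) by (cases "j = 1") auto
  ultimately show "herm_eigenvalue q d j (d - j + 2) \<le> herm_eigenvalue q d j i"
    using assms herm_eigenvalue_even_neg[of q j d] herm_eigenvalue_even_pos[of q j d i]
    by (intro herm_eigenvalue_neg_minimal) auto
qed

end
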